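(* Let $(\alpha_1,\dots,\alpha_m)\in[0,1]^m$ with $\sum_{k=1}^m\alpha_k=1$, let $x_1,\dots,x_m\in\mathbb{R}^d$, and define $Af:=\sum_{k=1}^m\alpha_kf(\cdot-x_k)$ for real-valued functions $f$ on $\mathbb{R}^d$. Let $c\in(0,1)$, let $g,h:\mathbb{R}^d\to\mathbb{R}$ satisfy $Ag\ge g$, $Ah=h$ and $0\vee g\le h$, and let $\mathcal{D}f:=(c\cdot Af)\vee g$ for nonnegative measurable $f$. Then the map $f\mapsto\mathcal{D}f\vee0$ is a sound iterative Bermudan option pricing algorithm for the payoff function $g\vee0$.
   Context: Let $L^0(\mathbb{R}^d,[0,+\infty))$ be the set of nonnegative measurable functions on $\mathbb{R}^d$ and $C^0(\mathbb{R}^d,[0,+\infty))$ the set of nonnegative continuous functions. A map $D:L^0(\mathbb{R}^d,[0,+\infty))\to L^0(\mathbb{R}^d,[0,+\infty))$ is a sound iterative Bermudan option pricing algorithm for a payoff function $g_0\in C^0(\mathbb{R}^d,[0,+\infty))$ if $Df\ge g_0$ for all $f\in L^0(\mathbb{R}^d,[0,+\infty))$ and $D$ is pointwise monotone, i.e. whenever $f_0(x)\le f_1(x)$ for all $x\in\mathbb{R}^d$, then $Df_0(x)\le Df_1(x)$ for all $x\in\mathbb{R}^d$. $\vee$ is the pointwise maximum.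
   Formalization: The formal theorem additionally assumes that the payoff g∨0 is continuous, as the notion of a payoff function requires; for arbitrary g the claim fails (m=1, x_1=0, g=h the indicator of a non-measurable set). *)

theory Defs
  imports "HOL-Analysis.Analysis"
begin

(* Measurable means Borel measurable; elements are genuine functions, not classes modulo
   null sets, because the order conditions below are pointwise everywhere. *)
definition L0_nonneg :: "(real ^ 'n \<Rightarrow> real) set" where
  "L0_nonneg = {f \<in> borel_measurable borel. \<forall>x. 0 \<le> f x}"

definition C0_nonneg :: "(real ^ 'n \<Rightarrow> real) set" where
  "C0_nonneg = {f. continuous_on UNIV f \<and> (\<forall>x. 0 \<le> f x)}"

(* D is a total HOL function; only its restriction to L0_nonneg matters. *)
definition sound_bermudan_algorithm ::
  "((real ^ 'n \<Rightarrow> real) \<Rightarrow> (real ^ 'n \<Rightarrow> real)) \<Rightarrow> (real ^ 'n \<Rightarrow> real) \<Rightarrow> bool" where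
  "sound_bermudan_algorithm D g\<^sub>0 \<longleftrightarrow>
     g\<^sub>0 \<in> C0_nonneg \<and>
     D \<in> L0_nonneg \<rightarrow> L0_nonneg \<and>
     (\<forall>f\<in>L0_nonneg. \<forall>x. g\<^sub>0 x \<le> D f x) \<and>
     (\<forall>f\<^sub>0\<in>L0_nonneg. \<forall>f\<^sub>1\<in>L0_nonneg.
        (\<forall>x. f\<^sub>0 x \<le> f\<^sub>1 x) \<longrightarrow> (\<forall>x. D f\<^sub>0 x \<le> D f\<^sub>1 x))"

definition translate_average ::
  "nat \<Rightarrow> (nat \<Rightarrow> real) \<Rightarrow> (nat \<Rightarrow> real ^ 'n) \<Rightarrow> (real ^ 'n \<Rightarrow> real) \<Rightarrow> (real ^ 'n \<Rightarrow> real)" where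
  "translate_average m \<alpha> x f = (\<lambda>y. \<Sum>k=1..m. \<alpha> k * f (y - x k))"

definition pricing_step ::
  "((real ^ 'n \<Rightarrow> real) \<Rightarrow> (real ^ 'n \<Rightarrow> real)) \<Rightarrow> real \<Rightarrow> (real ^ 'n \<Rightarrow> real)
     \<Rightarrow> (real ^ 'n \<Rightarrow> real) \<Rightarrow> (real ^ 'n \<Rightarrow> real)" where
  "pricing_step A c g f = (\<lambda>y. max (c * A f y) (g y))"

end

theory Submission
  imports Defs
begin

text \<open>
  Associativity of the maximum gives
  \<open>max (max (c * A f y) (g y)) 0 = max (c * A f y) (max (g y) 0)\<close>,
  in which \<open>g\<close> appears only through its positive part, the payoff. In this form the payoff is
  visibly a lower bound; measurability needs only that \<open>A\<close> preserves measurability and that the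
  payoff is continuous, although \<open>g\<close> itself may fail to be measurable; and monotonicity is
  that of \<open>A\<close>, an average with nonnegative weights, scaled by the positive factor \<open>c\<close>.
\<close>

lemma borel_measurable_translate_average:
  assumes [measurable]: "f \<in> borel_measurable borel"
  shows "translate_average m \<alpha> x f \<in> borel_measurable borel"
  unfolding translate_average_def by measurable

lemma translate_average_mono:
  assumes "\<And>k. k \<in> {1..m} \<Longrightarrow> 0 \<le> \<alpha> k" and "\<And>z. f\<^sub>0 z \<le> f\<^sub>1 z"
  shows "translate_average m \<alpha> x f\<^sub>0 y \<le> translate_average m \<alpha> x f\<^sub>1 y"
  unfolding translate_average_def by (intro sum_mono mult_left_mono assms)

lemma pricing_step_positive_part:
  "max (pricing_step A c g f y) 0 = max (c * A f y) (max (g y) 0)"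
  by (simp add: pricing_step_def max.assoc)

text \<open>
  The averaging operator enters only through measurability and pointwise monotonicity, so the
  result is isolated here for an arbitrary operator with these two properties.
\<close>

lemma sound_bermudan_algorithm_pricing_step:
  fixes A :: "(real ^ 'n \<Rightarrow> real) \<Rightarrow> (real ^ 'n \<Rightarrow> real)"
  assumes payoff: "(\<lambda>y. max (g y) 0) \<in> C0_nonneg"
    and "0 \<le> c"
    and A_measurable: "\<And>f. f \<in> L0_nonneg \<Longrightarrow> A f \<in> borel_measurable borel"
    and A_mono: "\<And>f\<^sub>0 f\<^sub>1 y. f\<^sub>0 \<in> L0_nonneg \<Longrightarrow> f\<^sub>1 \<in> L0_nonneg \<Longrightarrow>
                   (\<And>z. f\<^sub>0 z \<le> f\<^sub>1 z) \<Longrightarrow> A f\<^sub>0 y \<le> A f\<^sub>1 y"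
  shows "sound_bermudan_algorithm (\<lambda>f y. max (pricing_step A c g f y) 0) (\<lambda>y. max (g y) 0)"
  unfolding sound_bermudan_algorithm_def pricing_step_positive_part
proof (intro conjI ballI allI impI funcsetI)
  show "(\<lambda>y. max (g y) 0) \<in> C0_nonneg" by (fact payoff)
next
  fix f :: "real ^ 'n \<Rightarrow> real"
  assume "f \<in> L0_nonneg"
  then have [measurable]: "A f \<in> borel_measurable borel" by (rule A_measurable)
  have [measurable]: "(\<lambda>y. max (g y) 0) \<in> borel_measurable borel"
    using payoff by (simp add: C0_nonneg_def borel_measurable_continuous_onI)
  have "(\<lambda>y. max (c * A f y) (max (g y) 0)) \<in> borel_measurable borel"
    by (rule borel_measurable_max) measurable
  then show "(\<lambda>y. max (c * A f y) (max (g y) 0)) \<in> L0_nonneg"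
    by (simp add: L0_nonneg_def le_max_iff_disj)
next
  fix f :: "real ^ 'n \<Rightarrow> real" and y
  show "max (g y) 0 \<le> max (c * A f y) (max (g y) 0)" by (rule max.cobounded2)
next
  fix f\<^sub>0 f\<^sub>1 :: "real ^ 'n \<Rightarrow> real" and y
  assume "f\<^sub>0 \<in> L0_nonneg" "f\<^sub>1 \<in> L0_nonneg" "\<forall>z. f\<^sub>0 z \<le> f\<^sub>1 z"
  then have "c * A f\<^sub>0 y \<le> c * A f\<^sub>1 y"
    using \<open>0 \<le> c\<close> by (intro mult_left_mono A_mono) auto
  then show "max (c * A f\<^sub>0 y) (max (g y) 0) \<le> max (c * A f\<^sub>1 y) (max (g y) 0)"
    by (intro max.mono order_refl)
qed

theorem corollary6p1:
  fixes m :: nat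
    and \<alpha> :: "nat \<Rightarrow> real"
    and x :: "nat \<Rightarrow> real ^ 'n"
    and c :: real
    and g h :: "real ^ 'n \<Rightarrow> real"
    and A :: "(real ^ 'n \<Rightarrow> real) \<Rightarrow> (real ^ 'n \<Rightarrow> real)"
  defines "A \<equiv> translate_average m \<alpha> x"
  assumes "\<forall>k\<in>{1..m}. \<alpha> k \<in> {0..1}"
    and "(\<Sum>k=1..m. \<alpha> k) = 1"
    and "c \<in> {0<..<1}"
    and "(\<lambda>y. max (g y) 0) \<in> C0_nonneg"
    and "\<forall>y. A g y \<ge> g y"
    and "A h = h"
    and "\<forall>y. max 0 (g y) \<le> h y"
  shows "sound_bermudan_algorithm (\<lambda>f y. max (pricing_step A c g f y) 0) (\<lambda>y. max (g y) 0)"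
proof (rule sound_bermudan_algorithm_pricing_step)
  show "(\<lambda>y. max (g y) 0) \<in> C0_nonneg" by fact
  show "0 \<le> c" using \<open>c \<in> {0<..<1}\<close> by simp
  show "A f \<in> borel_measurable borel" if "f \<in> L0_nonneg" for f
    using that unfolding A_def L0_nonneg_def by (simp add: borel_measurable_translate_average)
  show "A f\<^sub>0 y \<le> A f\<^sub>1 y" if "\<And>z. f\<^sub>0 z \<le> f\<^sub>1 z" for f\<^sub>0 f\<^sub>1 y
    unfolding A_def using \<open>\<forall>k\<in>{1..m}. \<alpha> k \<in> {0..1}\<close> that
    by (intro translate_average_mono) auto
qed

end
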